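(* Let $b$ be any non-negative locally integrable function on $\mathbb{R}^n$. Then $$|[M,b]f(x)|\le C_b(f)(x)\qquad (x\in\mathbb{R}^n)$$ for all functions $f\in L_1^{\mathrm{loc}}(\mathbb{R}^n)$.
   Context: $L_1^{\mathrm{loc}}(\mathbb{R}^n)$ is the set of locally integrable functions on $\mathbb{R}^n$. Cubes in $\mathbb{R}^n$ have sides parallel to the coordinate axes. The Hardy–Littlewood maximal function is $Mf(x)=\sup_{Q\ni x}\frac1{|Q|}\int_Q|f(y)|\,dy$, the supremum being over all cubes $Q$ containing $x$. The maximal commutator is $C_b(f)(x)=\sup_{Q\ni x}\frac1{|Q|}\int_Q|b(x)-b(y)||f(y)|\,dy$, the supremum being over all cubes $Q$ containing $x$. The commutator of $M$ and $b$ is $[M,b]f(x)=M(bf)(x)-b(x)Mf(x)$.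
   Formalization: At points x where M(bf)(x) and b(x)Mf(x) are both infinite, the difference [M,b]f(x) is undefined (e.g. b = 1, f(y) = |y|²) and is taken to be 0, with 0·∞ = 0; so the bound is asserted exactly where the commutator is defined. *)

theory Defs
  imports "HOL-Analysis.Analysis"
begin

definition locally_integrable :: "(real^'n \<Rightarrow> 'b::{banach, second_countable_topology}) \<Rightarrow> bool"
  where "locally_integrable f \<longleftrightarrow> (\<forall>K. compact K \<longrightarrow> f absolutely_integrable_on K)"

(* Closed, non-degenerate cubes. Open or half-open cubes give the same suprema below. *)
definition cubes :: "(real^'n) set set"
  where "cubes = {cbox a (\<chi> i. a $ i + l) | a l. 0 < l}"

(* Maximal functions may be infinite, and b f need not be locally integrable, so the averages
   are Lebesgue integrals of non-negative functions with values in [0, \<infinity>]. *)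

definition maximal_function :: "(real^'n \<Rightarrow> 'b::real_normed_vector) \<Rightarrow> real^'n \<Rightarrow> ennreal"
  where "maximal_function f x =
    (SUP Q\<in>{Q \<in> cubes. x \<in> Q}.
       (\<integral>\<^sup>+y\<in>Q. ennreal (norm (f y)) \<partial>lebesgue) / emeasure lebesgue Q)"

definition maximal_commutator ::
    "(real^'n \<Rightarrow> real) \<Rightarrow> (real^'n \<Rightarrow> 'b::real_normed_vector) \<Rightarrow> real^'n \<Rightarrow> ennreal"
  where "maximal_commutator b f x =
    (SUP Q\<in>{Q \<in> cubes. x \<in> Q}.
       (\<integral>\<^sup>+y\<in>Q. ennreal (\<bar>b x - b y\<bar> * norm (f y)) \<partial>lebesgue) / emeasure lebesgue Q)"

(* Subtraction on ereal puts \<infinity> - \<infinity> = \<infinity>. Here the indeterminate difference is 0 instead: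
   if b = 1 and M f(x) = \<infinity>, then C_b(f)(x) = 0, so 0 is the only value for which the pointwise
   bound by C_b(f) can hold at every x. Products follow 0 * \<infinity> = 0. *)
definition commutator_maximal ::
    "(real^'n \<Rightarrow> real) \<Rightarrow> (real^'n \<Rightarrow> 'b::real_normed_vector) \<Rightarrow> real^'n \<Rightarrow> ereal"
  where "commutator_maximal b f x =
    (let u = enn2ereal (maximal_function (\<lambda>y. b y *\<^sub>R f y) x);
         v = ereal (b x) * enn2ereal (maximal_function f x)
     in if u = \<infinity> \<and> v = \<infinity> then 0 else u - v)"

end

(* On each cube Q containing x, integrate the pointwise bounds b(y) <= b(x) + |b(x) - b(y)| and
   b(x) <= b(y) + |b(x) - b(y)| against |f|. Taking suprema over Q gives
   M(bf)(x) <= b(x) Mf(x) + C_b(f)(x) and b(x) Mf(x) <= M(bf)(x) + C_b(f)(x) in [0, \<infinity>], which also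
   settles the cases of infinite maximal functions. *)

theory Submission
  imports Defs
begin

lemma compact_cubes: "Q \<in> cubes \<Longrightarrow> compact Q"
  by (auto simp: cubes_def)

text \<open>Local integrability gives integrability of \<open>indicator K y *\<^sub>R f y\<close>,
  hence measurability on each compact \<open>K\<close>. This suffices, as all averages are taken
  over compact cubes.\<close>

lemma locally_integrable_measurable_on:
  fixes f :: "real^'n \<Rightarrow> 'b::{banach, second_countable_topology}"
  assumes "locally_integrable f" "compact K"
  shows "f \<in> borel_measurable (restrict_space lebesgue K)"
proof -
  have K: "K \<in> sets lebesgue"
    using \<open>compact K\<close> by (simp add: borel_compact)
  have "(\<lambda>y. indicator K y *\<^sub>R f y) \<in> borel_measurable lebesgue"
    using assms by (auto simp: locally_integrable_def set_integrable_def dest: borel_measurable_integrable)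
  with K show ?thesis
    by (subst borel_measurable_restrict_space_iff) auto
qed

text \<open>Passing to \<open>restrict_space M Q\<close> turns measurability on \<open>Q\<close>
  into ordinary measurability, so that additivity of the integral applies.\<close>

lemma set_nn_integral_mono_add:
  assumes "Q \<in> sets M"
    and "g \<in> borel_measurable (restrict_space M Q)" "h \<in> borel_measurable (restrict_space M Q)"
    and "\<And>y. y \<in> Q \<Longrightarrow> k y \<le> g y + h y"
  shows "(\<integral>\<^sup>+y\<in>Q. k y \<partial>M) \<le> (\<integral>\<^sup>+y\<in>Q. g y \<partial>M) + (\<integral>\<^sup>+y\<in>Q. h y \<partial>M)"
proof -
  have Q: "Q \<inter> space M \<in> sets M" using assms(1) by auto
  have "(\<integral>\<^sup>+y\<in>Q. k y \<partial>M) = (\<integral>\<^sup>+y. k y \<partial>restrict_space M Q)"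
    by (simp add: nn_integral_restrict_space[OF Q])
  also have "\<dots> \<le> (\<integral>\<^sup>+y. g y + h y \<partial>restrict_space M Q)"
    using assms(4) by (intro nn_integral_mono) (auto simp: space_restrict_space)
  also have "\<dots> = (\<integral>\<^sup>+y. g y \<partial>restrict_space M Q) + (\<integral>\<^sup>+y. h y \<partial>restrict_space M Q)"
    using assms(2,3) by (rule nn_integral_add)
  finally show ?thesis
    by (simp add: nn_integral_restrict_space[OF Q])
qed

lemma maximal_functions_le_add_commutator:
  fixes b :: "real^'n \<Rightarrow> real"
    and f :: "real^'n \<Rightarrow> 'k::{real_normed_field, banach, second_countable_topology}"
  assumes b: "locally_integrable b" "\<And>x. 0 \<le> b x" and f: "locally_integrable f"
  shows "maximal_function (\<lambda>y. b y *\<^sub>R f y) x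
           \<le> ennreal (b x) * maximal_function f x + maximal_commutator b f x" (is "?u \<le> ?v + ?c")
    and "ennreal (b x) * maximal_function f x
           \<le> maximal_function (\<lambda>y. b y *\<^sub>R f y) x + maximal_commutator b f x"
proof -
  define I where "I Q g = (\<integral>\<^sup>+y\<in>Q. ennreal (g y) \<partial>lebesgue) / emeasure lebesgue Q"
    for Q :: "(real^'n) set" and g :: "real^'n \<Rightarrow> real"
  let ?g = "\<lambda>y. norm (f y)" and ?bg = "\<lambda>y. norm (b y *\<^sub>R f y)"
    and ?d = "\<lambda>y. \<bar>b x - b y\<bar> * norm (f y)"
  have M: "maximal_function f x = (SUP Q\<in>{Q \<in> cubes. x \<in> Q}. I Q ?g)"
          "?u = (SUP Q\<in>{Q \<in> cubes. x \<in> Q}. I Q ?bg)"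
          "?c = (SUP Q\<in>{Q \<in> cubes. x \<in> Q}. I Q ?d)"
    unfolding maximal_function_def maximal_commutator_def I_def by (rule refl)+
  \<comment> \<open>The signs of \<open>g1\<close> and \<open>g2\<close> matter because
    \<open>ennreal\<close> sends negative reals to 0 and is additive only on non-negative
    ones.\<close>
  have Isub: "I Q h \<le> I Q g1 + I Q g2"
    if "Q \<in> cubes" "g1 \<in> borel_measurable (restrict_space lebesgue Q)"
       "g2 \<in> borel_measurable (restrict_space lebesgue Q)"
       "\<And>y. h y \<le> g1 y + g2 y" "\<And>y. 0 \<le> g1 y" "\<And>y. 0 \<le> g2 y" for Q h g1 g2
  proof -
    have "Q \<in> sets lebesgue" using compact_cubes[OF that(1)] by (simp add: borel_compact)
    then show ?thesis
      unfolding I_def add_divide_distrib_ennreal[symmetric]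
      using that by (intro divide_right_mono_ennreal set_nn_integral_mono_add)
        (auto simp flip: ennreal_plus)
  qed
  have meas: "f \<in> borel_measurable (restrict_space lebesgue Q)"
    "b \<in> borel_measurable (restrict_space lebesgue Q)" if "Q \<in> cubes" for Q
    using locally_integrable_measurable_on[OF _ compact_cubes[OF that]] b f by auto
  have scale: "I Q (\<lambda>y. b x * ?g y) = ennreal (b x) * I Q ?g" if "Q \<in> cubes" for Q
  proof -
    have Q: "Q \<inter> space lebesgue \<in> sets lebesgue"
      using compact_cubes[OF that] by (simp add: borel_compact)
    have [measurable]: "f \<in> borel_measurable (restrict_space lebesgue Q)" using meas that by auto
    have "(\<integral>\<^sup>+y\<in>Q. ennreal (b x * ?g y) \<partial>lebesgue) = ennreal (b x) * (\<integral>\<^sup>+y\<in>Q. ennreal (?g y) \<partial>lebesgue)"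
      unfolding nn_integral_restrict_space[OF Q, symmetric]
      using b(2) by (subst nn_integral_cmult[symmetric]) (auto simp: ennreal_mult)
    then show ?thesis
      by (simp add: I_def ennreal_times_divide)
  qed
  \<comment> \<open>Since \<open>b\<close> is non-negative, \<open>?bg y\<close> equals
    \<open>b y * ?g y\<close>; both bounds are then the triangle inequality multiplied by
    \<open>?g y\<close>.\<close>
  have pt: "?bg y \<le> b x * ?g y + ?d y" "b x * ?g y \<le> ?bg y + ?d y" for y
    using b(2) mult_right_mono[of "b y" "b x + \<bar>b x - b y\<bar>" "?g y"]
      mult_right_mono[of "b x" "b y + \<bar>b x - b y\<bar>" "?g y"]
    by (auto simp: distrib_right)
  show "?u \<le> ?v + ?c"
    unfolding M(2)
  proof (rule SUP_least, clarify)
    fix Q assume Q: "Q \<in> cubes" "x \<in> Q"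
    note [measurable] = meas[OF Q(1)]
    have "I Q ?bg \<le> I Q (\<lambda>y. b x * ?g y) + I Q ?d"
      by (rule Isub[OF Q(1)]) (use pt b(2) in auto)
    also have "\<dots> \<le> ?v + ?c"
      unfolding scale[OF Q(1)] M using Q by (intro add_mono mult_left_mono SUP_upper) auto
    finally show "I Q ?bg \<le> ?v + ?c" .
  qed
  show "?v \<le> ?u + ?c"
    \<comment> \<open>In \<open>ennreal\<close> a constant factor, even 0 or
      \<open>\<infinity>\<close>, moves inside the supremum, so this bound too can be checked on one
      cube at a time.\<close>
    unfolding M(1) SUP_mult_left_ennreal
  proof (rule SUP_least, clarify)
    fix Q assume Q: "Q \<in> cubes" "x \<in> Q"
    note [measurable] = meas[OF Q(1)]
    have "ennreal (b x) * I Q ?g \<le> I Q ?bg + I Q ?d"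
      unfolding scale[OF Q(1), symmetric] by (rule Isub[OF Q(1)]) (use pt b(2) in auto)
    also have "\<dots> \<le> ?u + ?c"
      unfolding M using Q by (intro add_mono SUP_upper) auto
    finally show "ennreal (b x) * I Q ?g \<le> ?u + ?c" .
  qed
qed

text \<open>If exactly one of \<open>u\<close> and \<open>v\<close> is infinite, the hypotheses
  force \<open>c = \<infinity>\<close>. If both were infinite, the difference in
  \<open>ereal\<close> would be \<open>\<infinity>\<close> although \<open>c\<close> may be finite,
  hence the exclusion.\<close>

lemma abs_diff_le_enn2ereal:
  fixes u v c :: ennreal
  assumes "u \<le> v + c" "v \<le> u + c" "\<not> (u = \<infinity> \<and> v = \<infinity>)"
  shows "\<bar>enn2ereal u - enn2ereal v\<bar> \<le> enn2ereal c"
proof -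
  have "enn2ereal u \<le> enn2ereal v + enn2ereal c" "enn2ereal v \<le> enn2ereal u + enn2ereal c"
    "\<not> (enn2ereal u = \<infinity> \<and> enn2ereal v = \<infinity>)"
    using assms by (auto simp flip: plus_ennreal.rep_eq simp: less_eq_ennreal.rep_eq)
  then show ?thesis
    using enn2ereal_nonneg[of u] enn2ereal_nonneg[of v] enn2ereal_nonneg[of c]
    by (cases "enn2ereal u"; cases "enn2ereal v"; cases "enn2ereal c") auto
qed

theorem lemma5p1:
  fixes b :: "real^'n \<Rightarrow> real"
    and f :: "real^'n \<Rightarrow> 'k::{real_normed_field, banach, second_countable_topology}"
  assumes "locally_integrable b"
    and "\<And>x. 0 \<le> b x"
    and "locally_integrable f"
  shows "\<forall>x. \<bar>commutator_maximal b f x\<bar> \<le> enn2ereal (maximal_commutator b f x)"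
proof
  fix x
  \<comment> \<open>Because \<open>b x\<close> is non-negative, the product can be formed in
    \<open>ennreal\<close>, where the two inequalities were proved.\<close>
  have v: "ereal (b x) * enn2ereal (maximal_function f x)
      = enn2ereal (ennreal (b x) * maximal_function f x)"
    using assms(2) by (simp add: times_ennreal.rep_eq)
  show "\<bar>commutator_maximal b f x\<bar> \<le> enn2ereal (maximal_commutator b f x)"
    unfolding commutator_maximal_def v Let_def
    \<comment> \<open>When both terms are infinite the commutator is 0 by convention, and the bound
      holds because the right-hand side is non-negative.\<close>
    using abs_diff_le_enn2ereal[OF maximal_functions_le_add_commutator[OF assms, of x]]
    by auto
qed

end
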